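(* Let $k\ge 2$ be an integer and let $T$ be a tree of order at least $k$. Then $T$ has a proper coloring with colors from $\{0,1,\dots,k-1\}$ such that for every vertex $w$ of $T$ and every color $i\in\{0,1,\dots,k-1\}$, there is a vertex of color $i$ at distance at most $k-1$ from $w$.
   Context: A proper coloring assigns colors to vertices so that adjacent vertices receive different colors. Distance is the usual shortest-path distance in $T$ (a vertex is at distance $0$ from itself). *)

theory Defs
  imports "Graph_Theory.Graph_Theory"
begin

text \<open>
  A finite simple graph is a symmetric, loop-free digraph on a finite vertex set
  (locale \<^locale>\<open>pair_graph\<close>), each edge being a pair of opposite arcs.  The library's
  \<^const>\<open>tree\<close> does not describe undirected trees: traversing an edge back and forth is
  already a directed cycle of length 2, and hence no symmetric digraph with an edge is a
  \<^const>\<open>forest\<close>.  The cycles of the undirected graph are the directed cycles of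
  length at least 3.
\<close>

definition graph_cycle :: "'a pair_pre_digraph \<Rightarrow> ('a \<times> 'a) awalk \<Rightarrow> bool" where
  "graph_cycle G p \<longleftrightarrow> pre_digraph.cycle (with_proj G) p \<and> 3 \<le> length p"

definition graph_tree :: "'a pair_pre_digraph \<Rightarrow> bool" where
  "graph_tree G \<longleftrightarrow>
     pair_graph G \<and> Digraph_Component.connected (with_proj G) \<and> (\<nexists>p. graph_cycle G p)"

text \<open>The shortest-path distance is the infimum of walk costs when every arc has cost 1.\<close>

definition graph_dist :: "'a pair_pre_digraph \<Rightarrow> 'a \<Rightarrow> 'a \<Rightarrow> ereal" where
  "graph_dist G u v = wf_digraph.\<mu> (with_proj G) (\<lambda>_. 1) u v"

definition proper_coloring :: "'a pair_pre_digraph \<Rightarrow> nat \<Rightarrow> ('a \<Rightarrow> nat) \<Rightarrow> bool" where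
  "proper_coloring G k c \<longleftrightarrow>
     c ` pverts G \<subseteq> {0..<k} \<and> (\<forall>u v. (u, v) \<in> parcs G \<longrightarrow> c u \<noteq> c v)"

end

theory Submission
  imports Defs
begin

text \<open>
  Let \<open>x\<close>, \<open>y\<close> be the ends of a longest path, of length \<open>d\<close>, and root the tree at \<open>x\<close>.
  If \<open>d \<ge> k - 1\<close>, colour each vertex by its depth modulo \<open>k\<close>.  A vertex \<open>w\<close> of depth \<open>j\<close>
  finds the colours \<open>i \<le> j\<close> among its nearest ancestors.  For \<open>j < i < k\<close> take the vertex of depth
  \<open>i\<close> on the path from \<open>x\<close> to \<open>y\<close>: it lies between \<open>y\<close> and the meeting point of \<open>w\<close> and \<open>y\<close>,
  so its distance from \<open>w\<close> is at most \<open>dist w y - (d - i) \<le> i\<close>.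
  If \<open>d < k - 1\<close>, distances impose no constraint and any proper colouring using all \<open>k\<close> colours
  will do; one arises from the 2-colouring by repeatedly giving a new colour to one of two vertices
  with the same colour.
\<close>

text \<open>Acyclicity is expressed by saying that every edge is a bridge.\<close>

locale tree_rel =
  fixes V :: "'a set" and E :: "('a \<times> 'a) set"
  assumes finite_V: "finite V"
    and E_sub: "E \<subseteq> V \<times> V"
    and E_sym: "(u, v) \<in> E \<Longrightarrow> (v, u) \<in> E"
    and connected: "u \<in> V \<Longrightarrow> v \<in> V \<Longrightarrow> (u, v) \<in> E\<^sup>*"
    and bridge: "(u, v) \<in> E \<Longrightarrow> (v, u) \<notin> (E - {(v, u)})\<^sup>*"
begin

section \<open>Distances and ancestors in a rooted tree\<close>

lemma irrefl: "(u, u) \<notin> E"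
  using bridge by blast

lemma relpow_E_sym: "(u, v) \<in> E ^^ n \<Longrightarrow> (v, u) \<in> E ^^ n"
proof (induction n arbitrary: v)
  case (Suc n)
  then obtain w where "(u, w) \<in> E ^^ n" "(w, v) \<in> E" by auto
  with Suc.IH E_sym show ?case by (blast intro: relpow_Suc_I2)
qed auto

text \<open>A natural-valued distance that permits subtraction. It is meaningful only where some
  walk exists, which connectedness guarantees on \<open>V\<close>.\<close>

definition hop :: "'a \<Rightarrow> 'a \<Rightarrow> nat" where
  "hop u v = (LEAST n. (u, v) \<in> E ^^ n)"

lemma hop_walk: "u \<in> V \<Longrightarrow> v \<in> V \<Longrightarrow> (u, v) \<in> E ^^ hop u v"
  unfolding hop_def by (rule LeastI_ex) (use connected rtrancl_power in fast)

lemma hop_le: "(u, v) \<in> E ^^ n \<Longrightarrow> hop u v \<le> n"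
  unfolding hop_def by (rule Least_le)

lemma hop_refl [simp]: "hop u u = 0"
  using hop_le[of u u 0] by simp

text \<open>The root is made its own parent, so that \<open>parent x\<close> can be iterated freely.\<close>

definition parent :: "'a \<Rightarrow> 'a \<Rightarrow> 'a" where
  "parent x v = (if v = x then x else SOME u. (u, v) \<in> E \<and> hop x v = Suc (hop x u))"

text \<open>The penultimate vertex of a shortest walk from \<open>x\<close> to \<open>v\<close> is a
  valid choice for \<open>SOME\<close>.\<close>

lemma parent_edge:
  assumes "x \<in> V" "v \<in> V" "v \<noteq> x"
  shows "(parent x v, v) \<in> E" "hop x v = Suc (hop x (parent x v))"
proof -
  have walk: "(x, v) \<in> E ^^ hop x v" using assms by (simp add: hop_walk)
  with \<open>v \<noteq> x\<close> obtain n where n: "hop x v = Suc n" by (cases "hop x v") auto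
  with walk obtain u where u: "(x, u) \<in> E ^^ n" "(u, v) \<in> E" by auto
  then have "u \<in> V" using E_sub by auto
  then have "(x, v) \<in> E ^^ Suc (hop x u)" using u assms by (blast intro: hop_walk relpow_Suc_I)
  then have "hop x v \<le> Suc (hop x u)" by (rule hop_le)
  with n hop_le[OF u(1)] u(2) have "\<exists>u. (u, v) \<in> E \<and> hop x v = Suc (hop x u)" by auto
  from someI_ex[OF this] \<open>v \<noteq> x\<close>
  show "(parent x v, v) \<in> E" "hop x v = Suc (hop x (parent x v))" by (simp_all add: parent_def)
qed

lemma parent_root [simp]: "parent x x = x"
  by (simp add: parent_def)

lemma parent_in_V: "x \<in> V \<Longrightarrow> v \<in> V \<Longrightarrow> parent x v \<in> V"
  using parent_edge(1)[of x v] E_sub by (cases "v = x") auto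

lemma hop_parent: "x \<in> V \<Longrightarrow> v \<in> V \<Longrightarrow> hop x (parent x v) = hop x v - 1"
  using parent_edge(2)[of x v] by (cases "v = x") auto

text \<open>Otherwise no parent edge uses the arc \<open>(v, u)\<close> in either direction, so
  \<open>v\<close> reaches the root and then \<open>u\<close> along parent edges alone,
  contradicting \<open>bridge\<close>.\<close>

lemma edge_is_parent_edge:
  assumes x: "x \<in> V" and uv: "(u, v) \<in> E"
  shows "parent x u = v \<or> parent x v = u"
proof (rule ccontr)
  assume neg: "\<not> ?thesis"
  define P where "P = E - {(v, u)}"
  have "(w, x) \<in> P\<^sup>* \<and> (x, w) \<in> P\<^sup>*" if "w \<in> V" for w
    using that
  proof (induction "hop x w" arbitrary: w rule: less_induct)
    case less
    show ?case
    proof (cases "w = x")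
      case False
      note pe = parent_edge[OF x less.prems False]
      then have "(parent x w, w) \<in> P" "(w, parent x w) \<in> P"
        using neg E_sym by (auto simp: P_def)
      moreover have "(parent x w, x) \<in> P\<^sup>* \<and> (x, parent x w) \<in> P\<^sup>*"
        using less pe parent_in_V x by simp
      ultimately show ?thesis
        by (blast intro: converse_rtrancl_into_rtrancl rtrancl_into_rtrancl)
    qed simp
  qed
  then have "(v, u) \<in> P\<^sup>*" using uv E_sub by (blast intro: rtrancl_trans)
  with bridge[OF uv] show False by (simp add: P_def)
qed

lemma edge_cases:
  assumes "x \<in> V" "(u, v) \<in> E"
  obtains "parent x u = v" "hop x u = Suc (hop x v)"
    | "parent x v = u" "hop x v = Suc (hop x u)"
proof -
  have "u \<in> V" "v \<in> V" "u \<noteq> v" using assms E_sub irrefl by auto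
  then show thesis
    using that edge_is_parent_edge[OF assms] parent_edge(2)[OF assms(1)] parent_root by metis
qed

lemma ancestor_in_V: "x \<in> V \<Longrightarrow> v \<in> V \<Longrightarrow> (parent x ^^ n) v \<in> V"
  by (induction n) (auto simp: parent_in_V)

text \<open>Truncated subtraction matches the convention that the root is its own parent, so no
  bound on \<open>n\<close> is required.\<close>

lemma hop_ancestor: "x \<in> V \<Longrightarrow> v \<in> V \<Longrightarrow> hop x ((parent x ^^ n) v) = hop x v - n"
  by (induction n) (auto simp: hop_parent ancestor_in_V)

text \<open>Beyond \<open>hop x v\<close> steps the iteration stalls at the root, which has no loop;
  hence the bound on \<open>n\<close>.\<close>

lemma ancestor_walk:
  assumes "x \<in> V" "v \<in> V" "n \<le> hop x v"
  shows "(v, (parent x ^^ n) v) \<in> E ^^ n"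
  using assms(3)
proof (induction n)
  case (Suc n)
  let ?w = "(parent x ^^ n) v"
  have "hop x ?w \<noteq> 0" using Suc.prems assms by (simp add: hop_ancestor)
  then have "?w \<noteq> x" by auto
  then have "(parent x ?w, ?w) \<in> E" using assms by (simp add: parent_edge ancestor_in_V)
  with Suc E_sym show ?case by (auto intro: relpow_Suc_I)
qed simp

text \<open>Induction on the walk, prepending one edge. A step from a child to its parent raises
  \<open>m\<close>. A step from a parent to its child lowers \<open>m\<close>, or, if
  \<open>m\<close> is 0, the child is itself an ancestor of \<open>v\<close> and \<open>n\<close>
  grows instead.\<close>

lemma walk_common_ancestor:
  assumes "x \<in> V" "v \<in> V" "(u, v) \<in> E ^^ l"
  shows "\<exists>m n. m \<le> hop x u \<and> n \<le> hop x v \<and> (parent x ^^ m) u = (parent x ^^ n) v \<and> m + n \<le> l"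
  using assms(3)
proof (induction l arbitrary: u)
  case 0
  then show ?case by auto
next
  case (Suc l)
  then obtain u' where uu': "(u, u') \<in> E" and "(u', v) \<in> E ^^ l" by (blast elim: relpow_E2)
  with Suc.IH obtain m n where mn: "m \<le> hop x u'" "n \<le> hop x v"
    "(parent x ^^ m) u' = (parent x ^^ n) v" "m + n \<le> l" by blast
  from assms(1) uu' show ?case
  proof (cases rule: edge_cases)
    case 1
    with mn show ?thesis
      by (intro exI[of _ "Suc m"] exI[of _ n]) (auto simp: funpow_swap1)
  next
    case 2
    show ?thesis
    proof (cases m)
      case 0
      have "hop x u' = hop x v - n" using mn 0 hop_ancestor[OF assms(1,2), of n] by simp
      then show ?thesis
        using 0 2 mn by (intro exI[of _ 0] exI[of _ "Suc n"]) auto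
    next
      case (Suc m')
      then show ?thesis
        using 2 mn by (intro exI[of _ m'] exI[of _ n]) (auto simp: funpow_swap1)
    qed
  qed
qed

section \<open>Colorings of the tree\<close>

lemma mod_depth_proper:
  assumes "x \<in> V" "2 \<le> k" "(u, v) \<in> E"
  shows "hop x u mod k \<noteq> hop x v mod k"
proof -
  have "Suc n mod k \<noteq> n mod k" for n using assms(2) by (simp add: mod_Suc)
  then show ?thesis using edge_cases[OF assms(1,3)] by metis
qed

lemma surjective_coloring:
  assumes "2 \<le> m" "m \<le> card V"
  shows "\<exists>c :: 'a \<Rightarrow> nat. c ` V = {0..<m} \<and> (\<forall>u v. (u, v) \<in> E \<longrightarrow> c u \<noteq> c v)"
  using assms
proof (induction m rule: dec_induct)
  case base
  then obtain x y where xy: "x \<in> V" "y \<in> V" "y \<noteq> x"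
    by (metis card_2_iff' obtain_subset_with_card_n subsetD)
  \<comment> \<open>Both colors occur because the two ends of an edge already carry different
    ones.\<close>
  let ?c = "\<lambda>v. hop x v mod 2" and ?p = "parent x y"
  have "(?p, y) \<in> E" using xy by (simp add: parent_edge)
  then have "?c ?p \<noteq> ?c y" using xy by (intro mod_depth_proper) auto
  moreover have "?p \<in> V" using xy by (simp add: parent_in_V)
  moreover have "{0..<2} \<subseteq> {?c ?p, ?c y}" if "?c ?p \<noteq> ?c y" using that by auto
  ultimately have "{0..<2} \<subseteq> ?c ` V" using \<open>y \<in> V\<close> by blast
  then have "?c ` V = {0..<2}" by auto
  then show ?case using mod_depth_proper[OF xy(1), of 2] by blast
next
  case (step m)
  then obtain c :: "'a \<Rightarrow> nat" where c: "c ` V = {0..<m}" "\<And>u v. (u, v) \<in> E \<Longrightarrow> c u \<noteq> c v"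
    by auto
  have "\<not> inj_on c V" using c(1) step.prems card_image[of c V] by auto
  then obtain u v where uv: "u \<in> V" "v \<in> V" "u \<noteq> v" "c u = c v" by (auto simp: inj_on_def)
  \<comment> \<open>The color \<open>m\<close> is fresh, so recoloring \<open>u\<close> creates no
    conflict; the old color of \<open>u\<close> survives at \<open>v\<close>.\<close>
  let ?c = "c(u := m)"
  have "?c ` V = insert m (c ` (V - {u}))" using uv by auto
  also have "c ` (V - {u}) = c ` V"
  proof -
    have "c u \<in> c ` (V - {u})" using uv by (intro image_eqI[of _ _ v]) auto
    then show ?thesis using uv by blast
  qed
  finally have "?c ` V = {0..<Suc m}" using c(1) by auto
  moreover have "?c a \<noteq> ?c b" if ab: "(a, b) \<in> E" for a b
  proof -
    have "c a < m" "c b < m" using c(1) ab E_sub by force+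
    then show ?thesis using c(2)[OF ab] ab irrefl by auto
  qed
  ultimately show ?case by blast
qed

lemma mod_depth_dominating:
  assumes x: "x \<in> V" and y: "y \<in> V" and w: "w \<in> V"
    and longest: "hop w y \<le> hop x y"
    and k: "k - 1 \<le> hop x y" and i: "i < k"
  shows "\<exists>v \<in> V. hop x v mod k = i \<and> (\<exists>n \<le> k - 1. (w, v) \<in> E ^^ n)"
proof (cases "i \<le> hop x w")
  case True
  \<comment> \<open>The least number of steps upwards that brings the depth into the residue class
    of \<open>i\<close>.\<close>
  define n where "n = (hop x w - i) mod k"
  have "hop x w - n = i + k * ((hop x w - i) div k)"
    using True minus_mod_eq_mult_div[of "hop x w - i" k] mod_less_eq_dividend[of "hop x w - i" k]
    unfolding n_def by linarith
  then have "(hop x w - n) mod k = i" using i by simp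
  moreover have "n \<le> hop x w"
    unfolding n_def by (meson diff_le_self mod_less_eq_dividend order_trans)
  moreover have "n < k" using i by (simp add: n_def)
  ultimately show ?thesis
    using x w by (intro bexI[of _ "(parent x ^^ n) w"])
      (auto simp: hop_ancestor ancestor_in_V intro!: exI[of _ n] ancestor_walk)
next
  case False
  let ?d = "hop x y"
  obtain m n where mn: "m \<le> hop x w" "n \<le> ?d" "(parent x ^^ m) w = (parent x ^^ n) y" "m + n \<le> ?d"
    using walk_common_ancestor[OF x y hop_walk[OF w y]] longest by (meson order_trans)
  have "hop x w - m = ?d - n"
    using mn(3) hop_ancestor[OF x w, of m] hop_ancestor[OF x y, of n] by simp
  \<comment> \<open>The common ancestor has depth at most \<open>hop x w < i\<close>, so on the path
    from \<open>y\<close> to the root it lies above the vertex \<open>z\<close> of depth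
    \<open>i\<close>.\<close>
  with False have dn: "?d - i \<le> n" by linarith
  define z where "z = (parent x ^^ (?d - i)) y"
  have z: "z \<in> V" "hop x z = i"
    using x y k i by (auto simp: z_def hop_ancestor ancestor_in_V)
  define l where "l = n - (?d - i)"
  have "(parent x ^^ l) z = (parent x ^^ n) y"
    unfolding z_def l_def using dn
    by (metis add.commute comp_apply funpow_add le_add_diff_inverse)
  moreover have "l \<le> i" using mn(2) k i by (simp add: l_def)
  ultimately have "(z, (parent x ^^ m) w) \<in> E ^^ l"
    using ancestor_walk[OF x z(1), of l] z(2) mn(3) by simp
  then have "((parent x ^^ m) w, z) \<in> E ^^ l" by (rule relpow_E_sym)
  with ancestor_walk[OF x w mn(1)] have "(w, z) \<in> E ^^ (m + l)" by (auto simp: relpow_add)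
  \<comment> \<open>Here \<open>m + l = m + n - (?d - i)\<close>, which is at most \<open>i\<close>
    because \<open>m + n\<close> is at most \<open>?d\<close>.\<close>
  moreover have "m + l \<le> k - 1" using mn(4) dn k i by (simp add: l_def)
  ultimately show ?thesis using z i by (intro bexI[of _ z]) auto
qed

lemma dominating_coloring:
  assumes k: "2 \<le> k" "k \<le> card V"
  shows "\<exists>c. c ` V \<subseteq> {0..<k} \<and> (\<forall>u v. (u, v) \<in> E \<longrightarrow> c u \<noteq> c v) \<and>
    (\<forall>w\<in>V. \<forall>i\<in>{0..<k}. \<exists>v\<in>V. c v = i \<and> (\<exists>n \<le> k - 1. (w, v) \<in> E ^^ n))"
proof (cases "\<exists>u\<in>V. \<exists>v\<in>V. k - 1 \<le> hop u v")
  case True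
  let ?D = "case_prod hop ` (V \<times> V)"
  have fin: "finite ?D" "?D \<noteq> {}" using finite_V True by auto
  from Max_in[OF fin] obtain x y where xy: "x \<in> V" "y \<in> V" "hop x y = Max ?D" by auto
  have longest: "hop u v \<le> hop x y" if "u \<in> V" "v \<in> V" for u v
    unfolding xy(3) using that fin by (intro Max_ge) auto
  then have "k - 1 \<le> hop x y" using True le_trans by blast
  then show ?thesis
    using mod_depth_dominating[OF xy(1,2)] mod_depth_proper[OF xy(1) k(1)] longest xy k
    by (intro exI[of _ "\<lambda>v. hop x v mod k"]) auto
next
  case False
  from surjective_coloring[OF k] obtain c :: "'a \<Rightarrow> nat"
    where c: "c ` V = {0..<k}" "\<And>u v. (u, v) \<in> E \<Longrightarrow> c u \<noteq> c v" by auto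
  have "\<exists>v\<in>V. c v = i \<and> (\<exists>n \<le> k - 1. (w, v) \<in> E ^^ n)" if "w \<in> V" "i \<in> {0..<k}" for w i
  proof -
    obtain v where "v \<in> V" "c v = i" using c(1) \<open>i \<in> {0..<k}\<close> by (metis imageE)
    then show ?thesis using hop_walk[OF \<open>w \<in> V\<close>] False \<open>w \<in> V\<close> by (meson nle_le)
  qed
  with c show ?thesis by blast
qed

end

section \<open>Transfer to the library's graphs\<close>

lemma (in pair_wf_digraph) rtrancl_imp_awalk:
  assumes "(u, v) \<in> R\<^sup>*" "R \<subseteq> parcs G" "v \<in> pverts G"
  shows "\<exists>p. awalk u p v \<and> set p \<subseteq> R"
  using assms(1)
proof (induction rule: converse_rtrancl_induct)
  case base
  then show ?case using assms(3) by (auto simp: awalk_Nil_iff intro: exI[of _ "[]"])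
next
  case (step u u')
  then obtain p where "awalk u' p v" "set p \<subseteq> R" by blast
  with step.hyps assms(2) in_arcsD1 show ?case
    by (intro exI[of _ "(u, u') # p"]) (auto simp: awalk_Cons_iff)
qed

text \<open>A path from \<open>v\<close> to \<open>u\<close> avoiding the arc \<open>(v, u)\<close>
  would be closed by \<open>(u, v)\<close> to a cycle.\<close>

lemma graph_tree_bridge:
  assumes "graph_tree T" and uv: "(u, v) \<in> parcs T"
  shows "(v, u) \<notin> (parcs T - {(v, u)})\<^sup>*"
proof
  assume "(v, u) \<in> (parcs T - {(v, u)})\<^sup>*"
  interpret pair_graph T using assms by (simp add: graph_tree_def)
  have V: "u \<in> pverts T" "u \<noteq> v" using uv in_arcsD1 no_loops' by auto
  obtain q where q: "awalk v q u" "set q \<subseteq> parcs T - {(v, u)}"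
    using rtrancl_imp_awalk[OF \<open>(v, u) \<in> _\<close>] V by auto
  define p where "p = awalk_to_apath q"
  have p: "apath v p u" "set p \<subseteq> parcs T - {(v, u)}"
    using q apath_awalk_to_apath[of v q u] awalk_to_apath_subset[of v q u] by (auto simp: p_def)
  then have walk: "awalk v p u" "distinct (awalk_verts v p)" by (auto simp: apath_def)
  \<comment> \<open>An empty path would force \<open>u = v\<close>, and a single arc would be the
    deleted \<open>(v, u)\<close>; so the cycle has length at least 3.\<close>
  have "2 \<le> length p"
    using p(2) walk(1) V by (cases p; cases "tl p") (auto simp: awalk_Cons_iff awalk_Nil_iff)
  moreover have "cycle ((u, v) # p)"
    unfolding cycle_def using walk uv by (auto simp: awalk_Cons_iff intro!: exI[of _ u])
  ultimately have "graph_cycle T ((u, v) # p)" by (simp add: graph_cycle_def)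
  with assms(1) show False by (auto simp: graph_tree_def)
qed

text \<open>With unit costs a walk costs its length, and the infimum lies below the cost of any
  walk.\<close>

lemma (in pair_wf_digraph) graph_dist_le_relpow:
  assumes "(u, v) \<in> parcs G ^^ n" "v \<in> pverts G"
  shows "graph_dist G u v \<le> ereal (real n)"
proof -
  have "\<exists>p. awalk u p v \<and> awalk_cost (\<lambda>_. 1) p = real n"
    using assms(1)
  proof (induction n arbitrary: u)
    case 0
    then show ?case using assms(2) by (auto simp: awalk_Nil_iff intro!: exI[of _ "[]"])
  next
    case (Suc n)
    then obtain u' where u': "(u, u') \<in> parcs G" "(u', v) \<in> parcs G ^^ n"
      by (blast elim: relpow_E2)
    with Suc.IH obtain p where "awalk u' p v" "awalk_cost (\<lambda>_. 1) p = real n" by blast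
    with u'(1) in_arcsD1 show ?case
      by (intro exI[of _ "(u, u') # p"]) (auto simp: awalk_Cons_iff)
  qed
  then show ?thesis unfolding graph_dist_def by (metis min_cost_le_walk_cost)
qed

lemma graph_tree_tree_rel:
  assumes "graph_tree T"
  shows "tree_rel (pverts T) (parcs T)"
proof -
  interpret pair_graph T using assms by (simp add: graph_tree_def)
  show ?thesis
  proof
    show "finite (pverts T)" by simp
    show "parcs T \<subseteq> pverts T \<times> pverts T" using in_arcsD1 in_arcsD2 by auto
    show "(v, u) \<in> parcs T" if "(u, v) \<in> parcs T" for u v using that by (rule arcs_symmetric)
    show "(v, u) \<notin> (parcs T - {(v, u)})\<^sup>*" if "(u, v) \<in> parcs T" for u v
      using assms that by (rule graph_tree_bridge)
    \<comment> \<open>Connectedness in the library ignores arc directions; symmetry of the arcs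
      turns it into directed reachability.\<close>
    have "strongly_connected T" using assms pair_sym_arcs
      by (simp add: graph_tree_def symmetric_connected_imp_strongly_connected)
    then show "(u, v) \<in> (parcs T)\<^sup>*" if "u \<in> pverts T" "v \<in> pverts T" for u v
      using that by (auto simp: strongly_connected_def reachable_def intro: rtrancl_on_rtranclI)
  qed
qed

theorem theorem2:
  fixes k :: nat and T :: "'a pair_pre_digraph"
  assumes "k \<ge> 2"
    and "graph_tree T"
    and "card (pverts T) \<ge> k"
  shows "\<exists>c. proper_coloring T k c \<and>
           (\<forall>w \<in> pverts T. \<forall>i \<in> {0..<k}. \<exists>v \<in> pverts T.
              c v = i \<and> graph_dist T w v \<le> ereal (real (k - 1)))"
proof -
  interpret pair_graph T using assms(2) by (simp add: graph_tree_def)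
  interpret tr: tree_rel "pverts T" "parcs T" using assms(2) by (rule graph_tree_tree_rel)
  have dist: "graph_dist T w v \<le> ereal (real (k - 1))"
    if "(w, v) \<in> parcs T ^^ n" "n \<le> k - 1" "v \<in> pverts T" for w v n
    using graph_dist_le_relpow[OF that(1,3)] that(2) by (meson ereal_less_eq(3) of_nat_mono order_trans)
  obtain c where "c ` pverts T \<subseteq> {0..<k}" "\<forall>u v. (u, v) \<in> parcs T \<longrightarrow> c u \<noteq> c v"
    "\<forall>w\<in>pverts T. \<forall>i\<in>{0..<k}. \<exists>v\<in>pverts T. c v = i \<and> (\<exists>n \<le> k - 1. (w, v) \<in> parcs T ^^ n)"
    using tr.dominating_coloring[OF assms(1,3)] by blast
  then show ?thesis unfolding proper_coloring_def using dist by (intro exI[of _ c]) meson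
qed

end
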